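(* Let $n,d\ge 1$ and let $A\subset\mathbb R^n$ be a finite set such that $I_{1,d}(A)$ has basis $\{f_1,\dots,f_s\}$, where $\tilde A$ is finite, $I_{1,d}(A)$ is full, and $f=\sum_{j=1}^s f_j^2$ has no zeros at infinity. Suppose further that there exists $g\in I_{2,2d}(A)\smallsetminus I_{1,d}^2(A)$ such that $g(w)>0$ for each $w\in\tilde A$. Then there exists $c>0$ such that $$p_c=\sum_{j=1}^s f_j^2+c\,g$$ is positive and not sos.
   Context: A real polynomial $p(x_1,\dots,x_n)$ is positive (or psd) if $p(a)\ge 0$ for all $a\in\mathbb R^n$, and sos if it is a finite sum of squares of real polynomials. $\mathbb R_{n,d}$ is the vector space of real polynomials in $x_1,\dots,x_n$ of degree at most $d$. For a finite set $A\subset\mathbb R^n$: - $I_{1,d}(A)=\{p\in\mathbb R_{n,d}: p(\pi)=0 \text{ for all }\pi\in A\}$; - $I_{2,2d}(A)=\{p\in\mathbb R_{n,2d}: p(\pi)=\frac{\partial p}{\partial x_i}(\pi)=0 \text{ for all }\pi\in A,\ 1\le i\le n\}$; - $I_{1,d}^2(A)=\{\sum_i f_ig_i \text{ (finite sums)}: f_i,g_i\in I_{1,d}(A)\}$. If $\{f_1,\dots,f_s\}$ is a basis of $I_{1,d}(A)$, then $\tilde A$ is the set of common real zeros in $\mathbb R^n$ of $f_1,\dots,f_s$ that are not in $A$. $I_{1,d}(A)$ (also: $A$) is full if for every $\pi\in A$ and $v\in\mathbb R^n$ there is $f\in I_{1,d}(A)$ with $\vec\nabla f(\pi)=v$. The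 homogenization of a polynomial $f$ of degree $m$ is $F(x_1,\dots,x_{n+1})=x_{n+1}^m f(x_1/x_{n+1},\dots,x_n/x_{n+1})$; $f$ has a zero at infinity if $F(a)=0$ for some nonzero $a\in\mathbb R^{n+1}$ with $a_{n+1}=0$. *)

theory Defs
  imports "HOL-Analysis.Analysis" "HOL-Library.Poly_Mapping"
begin

(* Real polynomials whose variables are indexed by 'n; a monomial is its exponent vector.  With
   'n :: finite these are the polynomials in n = CARD('n) variables (so n \<ge> 1), evaluated at
   points of real ^ 'n. *)

type_synonym 'n mpoly = "('n \<Rightarrow>\<^sub>0 nat) \<Rightarrow>\<^sub>0 real"

definition mon_degree :: "('n::finite \<Rightarrow>\<^sub>0 nat) \<Rightarrow> nat" where
  "mon_degree m = (\<Sum>i\<in>UNIV. Poly_Mapping.lookup m i)"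

(* The zero polynomial gets degree 0. *)
definition tdegree :: "'n::finite mpoly \<Rightarrow> nat" where
  "tdegree p = Max (insert 0 (mon_degree ` Poly_Mapping.keys p))"

definition peval :: "'n::finite mpoly \<Rightarrow> real ^ 'n \<Rightarrow> real" where
  "peval p x = (\<Sum>m\<in>Poly_Mapping.keys p. Poly_Mapping.lookup p m * (\<Prod>i\<in>UNIV. (x $ i) ^ Poly_Mapping.lookup m i))"

definition pscale :: "real \<Rightarrow> 'n mpoly \<Rightarrow> 'n mpoly" where
  "pscale c p = Poly_Mapping.map ((*) c) p"

lemma lookup_pscale: "Poly_Mapping.lookup (pscale c p) m = c * Poly_Mapping.lookup p m"
  unfolding pscale_def by (simp add: Poly_Mapping.map.rep_eq when_def)

global_interpretation mpoly: vector_space pscale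
  by standard (auto intro!: poly_mapping_eqI simp: lookup_pscale lookup_add algebra_simps)

(* Formal partial derivative.  If lookup m i = 0, the truncated exponent is harmless, since the
   coefficient vanishes. *)
definition ppderiv :: "'n::finite \<Rightarrow> 'n mpoly \<Rightarrow> 'n mpoly" where
  "ppderiv i p = (\<Sum>m\<in>Poly_Mapping.keys p.
     Poly_Mapping.single (m - Poly_Mapping.single i 1) (real (Poly_Mapping.lookup m i) * Poly_Mapping.lookup p m))"

definition pgrad :: "'n::finite mpoly \<Rightarrow> real ^ 'n \<Rightarrow> real ^ 'n" where
  "pgrad p x = (\<chi> i. peval (ppderiv i p) x)"

definition positive_poly :: "'n::finite mpoly \<Rightarrow> bool" where
  "positive_poly p \<longleftrightarrow> (\<forall>a. peval p a \<ge> 0)"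

definition sos_poly :: "'n mpoly \<Rightarrow> bool" where
  "sos_poly p \<longleftrightarrow> (\<exists>(k::nat) h. p = (\<Sum>j<k. (h j)\<^sup>2))"

definition polys_upto :: "nat \<Rightarrow> 'n::finite mpoly set" where
  "polys_upto d = {p. tdegree p \<le> d}"

definition I1 :: "nat \<Rightarrow> (real ^ 'n::finite) set \<Rightarrow> 'n mpoly set" where
  "I1 d A = {p \<in> polys_upto d. \<forall>\<pi>\<in>A. peval p \<pi> = 0}"

(* The order of vanishing is 2, the degree bound is the parameter e; it is used with e = 2 * d. *)
definition I2 :: "nat \<Rightarrow> (real ^ 'n::finite) set \<Rightarrow> 'n mpoly set" where
  "I2 e A = {p \<in> polys_upto e. \<forall>\<pi>\<in>A. peval p \<pi> = 0 \<and> (\<forall>i. peval (ppderiv i p) \<pi> = 0)}"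

definition I1_squared :: "nat \<Rightarrow> (real ^ 'n::finite) set \<Rightarrow> 'n mpoly set" where
  "I1_squared d A = {p. \<exists>(k::nat) f g. (\<forall>j<k. f j \<in> I1 d A \<and> g j \<in> I1 d A) \<and>
                                       p = (\<Sum>j<k. f j * g j)}"

definition is_basis :: "(nat \<Rightarrow> 'n mpoly) \<Rightarrow> nat \<Rightarrow> 'n mpoly set \<Rightarrow> bool" where
  "is_basis f s V \<longleftrightarrow> inj_on f {1..s} \<and> mpoly.independent (f ` {1..s}) \<and>
                     mpoly.span (f ` {1..s}) = V"

definition extra_zeros :: "(nat \<Rightarrow> 'n::finite mpoly) \<Rightarrow> nat \<Rightarrow> (real ^ 'n) set \<Rightarrow> (real ^ 'n) set" where
  "extra_zeros f s A = {x. \<forall>j\<in>{1..s}. peval (f j) x = 0} - A"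

definition full :: "nat \<Rightarrow> (real ^ 'n::finite) set \<Rightarrow> bool" where
  "full d A \<longleftrightarrow> (\<forall>\<pi>\<in>A. \<forall>v. \<exists>p\<in>I1 d A. pgrad p \<pi> = v)"

(* The n + 1 variables of a homogenization are indexed by 'n option, with None in the role of
   the additional variable. *)
definition hom_mon :: "nat \<Rightarrow> ('n::finite \<Rightarrow>\<^sub>0 nat) \<Rightarrow> 'n option \<Rightarrow>\<^sub>0 nat" where
  "hom_mon k m = Abs_poly_mapping (case_option (k - mon_degree m) (Poly_Mapping.lookup m))"

definition homogenize :: "'n::finite mpoly \<Rightarrow> 'n option mpoly" where
  "homogenize p = (\<Sum>m\<in>Poly_Mapping.keys p. Poly_Mapping.single (hom_mon (tdegree p) m) (Poly_Mapping.lookup p m))"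

definition zero_at_infinity :: "'n::finite mpoly \<Rightarrow> bool" where
  "zero_at_infinity p \<longleftrightarrow> (\<exists>a. a \<noteq> 0 \<and> a $ None = 0 \<and> peval (homogenize p) a = 0)"


lemma peval_superset:
  assumes "finite S" "Poly_Mapping.keys p \<subseteq> S"
  shows "peval p x = (\<Sum>m\<in>S. Poly_Mapping.lookup p m * (\<Prod>i\<in>UNIV. (x $ i) ^ Poly_Mapping.lookup m i))"
  unfolding peval_def using assms by (intro sum.mono_neutral_left) (auto simp: in_keys_iff)

lemma peval_0 [simp]: "peval 0 x = 0"
  by (simp add: peval_def)

lemma peval_single: "peval (Poly_Mapping.single m c) x = c * (\<Prod>i\<in>UNIV. (x $ i) ^ Poly_Mapping.lookup m i)"
  by (subst peval_superset[where S = "{m}"]) auto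

lemma peval_add: "peval (p + q) x = peval p x + peval q x"
proof -
  let ?S = "Poly_Mapping.keys p \<union> Poly_Mapping.keys q"
  have "Poly_Mapping.keys (p + q) \<subseteq> ?S" by (rule keys_add)
  then show ?thesis
    by (simp add: peval_superset[where S = ?S] lookup_add algebra_simps sum.distrib)
qed

lemma peval_sum: "peval (sum f S) x = (\<Sum>j\<in>S. peval (f j) x)"
  by (induction S rule: infinite_finite_induct) (auto simp: peval_add)

lemma GDERIV_peval: "GDERIV (peval p) x :> pgrad p x"
proof -
  define M where "M = (\<lambda>m i. \<Prod>j\<in>UNIV. (x $ j) ^ Poly_Mapping.lookup (m - Poly_Mapping.single i (1::nat)) j)"
  have split: "M m i = (x $ i) ^ (Poly_Mapping.lookup m i - 1) * (\<Prod>j\<in>UNIV-{i}. (x $ j) ^ Poly_Mapping.lookup m j)" for m i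
    unfolding M_def
    by (subst prod.remove[where x = i]) (auto simp: lookup_minus lookup_single when_def intro!: prod.cong)
  have pd: "peval (ppderiv i p) x = (\<Sum>m\<in>Poly_Mapping.keys p. real (Poly_Mapping.lookup m i) * Poly_Mapping.lookup p m * M m i)" for i
    by (simp add: ppderiv_def peval_sum peval_single M_def)
  have nth: "((\<lambda>y. y $ i) has_derivative (\<lambda>h. h $ i)) (at x)" for i
    by (rule bounded_linear_imp_has_derivative) (rule bounded_linear_vec_nth)
  have pow: "((\<lambda>y. (y $ i) ^ k) has_derivative (\<lambda>h. real k * (h $ i) * (x $ i) ^ (k - 1))) (at x)" for i k
    by (rule has_derivative_power[OF nth])
  have "(peval p has_derivative (\<lambda>h. \<Sum>m\<in>Poly_Mapping.keys p. Poly_Mapping.lookup p m * (\<Sum>i\<in>UNIV.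
          real (Poly_Mapping.lookup m i) * (h $ i) * (x $ i) ^ (Poly_Mapping.lookup m i - 1) *
          (\<Prod>j\<in>UNIV-{i}. (x $ j) ^ Poly_Mapping.lookup m j)))) (at x)"
    unfolding peval_def[abs_def]
    by (intro has_derivative_sum has_derivative_mult_right has_derivative_prod pow)
  also have "(\<lambda>h. \<Sum>m\<in>Poly_Mapping.keys p. Poly_Mapping.lookup p m * (\<Sum>i\<in>UNIV.
          real (Poly_Mapping.lookup m i) * (h $ i) * (x $ i) ^ (Poly_Mapping.lookup m i - 1) *
          (\<Prod>j\<in>UNIV-{i}. (x $ j) ^ Poly_Mapping.lookup m j)))
        = (\<lambda>h. h \<bullet> pgrad p x)"
  proof
    fix h
    show "(\<Sum>m\<in>Poly_Mapping.keys p. Poly_Mapping.lookup p m * (\<Sum>i\<in>UNIV.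
          real (Poly_Mapping.lookup m i) * (h $ i) * (x $ i) ^ (Poly_Mapping.lookup m i - 1) *
          (\<Prod>j\<in>UNIV-{i}. (x $ j) ^ Poly_Mapping.lookup m j))) = h \<bullet> pgrad p x"
      unfolding inner_vec_def pgrad_def
      by (simp add: pd split sum_distrib_left mult_ac) (rule sum.swap)
  qed
  finally show ?thesis by (simp add: gderiv_def)
qed

lemma peval_homogenize:
  assumes "a $ None \<noteq> 0"
  shows "peval (homogenize p) a = (a $ None) ^ tdegree p * peval p (\<chi> i. a $ Some i / a $ None)"
proof -
  have U: "(UNIV :: 'a option set) = insert None (range Some)"
    by (simp add: UNIV_option_conv)
  have l: "Poly_Mapping.lookup (hom_mon k m) = case_option (k - mon_degree m) (Poly_Mapping.lookup m)" for k and m :: "'a \<Rightarrow>\<^sub>0 nat"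
    unfolding hom_mon_def by simp
  have "(\<Prod>i\<in>UNIV. (a $ i) ^ Poly_Mapping.lookup (hom_mon (tdegree p) m) i)
      = (a $ None) ^ tdegree p * (\<Prod>i\<in>UNIV. (a $ Some i / a $ None) ^ Poly_Mapping.lookup m i)"
    if "m \<in> Poly_Mapping.keys p" for m
  proof -
    have "mon_degree m \<le> tdegree p"
      unfolding tdegree_def using that by (intro Max_ge) auto
    moreover have "(\<Prod>i\<in>UNIV. (a $ Some i / a $ None) ^ Poly_Mapping.lookup m i)
        = (\<Prod>i\<in>UNIV. (a $ Some i) ^ Poly_Mapping.lookup m i) / (a $ None) ^ mon_degree m"
      by (simp add: power_divide prod_dividef mon_degree_def power_sum)
    ultimately show ?thesis
      using assms by (simp add: U l prod.reindex power_diff)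
  qed
  then show ?thesis
    unfolding homogenize_def peval_sum peval_single
    by (simp add: peval_def sum_distrib_left mult_ac)
qed

end

theory Submission
  imports Defs
begin

text \<open>A representation \<open>F + c g = \<Sum> h\<^sub>j\<^sup>2\<close>, where \<open>F = \<Sum> f\<^sub>j\<^sup>2\<close>, forces \<open>h\<^sub>j \<in> I\<^bsub>1,d\<^esub>(A)\<close>, since the
  left-hand side has degree at most \<open>2d\<close> and vanishes on \<open>A\<close>; hence \<open>g\<close> would lie in
  \<open>I\<^bsub>1,d\<^esub>\<^sup>2(A)\<close>. Positivity for small \<open>c\<close> amounts to a global bound \<open>- g \<le> C F\<close>. It holds near
  infinity because \<open>F\<close> has degree exactly \<open>2d\<close> and no zeros there; near a point of \<open>A\<close>
  because \<open>g\<close> vanishes to second order while, by fullness, \<open>F\<close> grows quadratically; near the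
  other zeros of \<open>F\<close> because \<open>g > 0\<close> there; and near all other points by continuity.
  Compactness of a large ball makes the bound uniform.\<close>

section \<open>Products, evaluation and degree of polynomials\<close>

lemma poly_mapping_sum_single:
  "p = (\<Sum>m\<in>Poly_Mapping.keys p. Poly_Mapping.single m (Poly_Mapping.lookup p m))"
  by (rule poly_mapping_eqI)
    (auto simp: lookup_sum lookup_single when_def in_keys_iff)

lemma poly_mapping_mult_eq_sum_single:
  fixes p q :: "'a::monoid_add \<Rightarrow>\<^sub>0 'b::semiring_0"
  shows "p * q = (\<Sum>a\<in>Poly_Mapping.keys p. \<Sum>b\<in>Poly_Mapping.keys q.
    Poly_Mapping.single (a + b) (Poly_Mapping.lookup p a * Poly_Mapping.lookup q b))"
  by (subst poly_mapping_sum_single[of p], subst poly_mapping_sum_single[of q])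
    (simp add: sum_product mult_single)

text \<open>With only one way to split the exponent \<open>u + v\<close>, the convolution collapses
  to a single term. If \<open>u\<close> or \<open>v\<close> is not a key, both sides are 0.\<close>

lemma lookup_mult_unique:
  fixes p q :: "'a::monoid_add \<Rightarrow>\<^sub>0 'b::semiring_0"
  assumes "\<And>a b. a \<in> Poly_Mapping.keys p \<Longrightarrow> b \<in> Poly_Mapping.keys q \<Longrightarrow> a + b = u + v
    \<Longrightarrow> a = u \<and> b = v"
  shows "Poly_Mapping.lookup (p * q) (u + v) = Poly_Mapping.lookup p u * Poly_Mapping.lookup q v"
proof -
  have "Poly_Mapping.lookup (p * q) (u + v) =
      (\<Sum>a\<in>Poly_Mapping.keys p. \<Sum>b\<in>Poly_Mapping.keys q.
        if a = u \<and> b = v then Poly_Mapping.lookup p u * Poly_Mapping.lookup q v else 0)"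
    unfolding poly_mapping_mult_eq_sum_single lookup_sum
    using assms by (intro sum.cong refl) (auto simp: lookup_single when_def)
  also have "\<dots> = (\<Sum>a\<in>Poly_Mapping.keys p. if a = u then \<Sum>b\<in>Poly_Mapping.keys q.
        if b = v then Poly_Mapping.lookup p u * Poly_Mapping.lookup q v else 0 else 0)"
    by (intro sum.cong refl) auto
  also have "\<dots> = Poly_Mapping.lookup p u * Poly_Mapping.lookup q v"
    by (auto simp: sum.delta' sum.delta in_keys_iff cong: if_cong)
  finally show ?thesis .
qed

lemma peval_mult: "peval (p * q) x = peval p x * peval q x"
proof -
  have "peval (p * q) x = (\<Sum>a\<in>Poly_Mapping.keys p. \<Sum>b\<in>Poly_Mapping.keys q.
      (Poly_Mapping.lookup p a * (\<Prod>i\<in>UNIV. (x $ i) ^ Poly_Mapping.lookup a i)) *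
      (Poly_Mapping.lookup q b * (\<Prod>i\<in>UNIV. (x $ i) ^ Poly_Mapping.lookup b i)))"
    by (simp add: poly_mapping_mult_eq_sum_single peval_sum peval_single lookup_add power_add
        prod.distrib mult_ac)
  then show ?thesis
    by (simp add: peval_def sum_product)
qed

lemma peval_power2: "peval (p\<^sup>2) x = (peval p x)\<^sup>2"
  by (simp add: power2_eq_square peval_mult)

lemma pscale_conv_mult: "pscale c p = Poly_Mapping.single 0 c * p"
  unfolding pscale_def by (rule mult_map_scale_conv_mult)

lemma peval_pscale: "peval (pscale c p) x = c * peval p x"
  by (simp add: pscale_conv_mult peval_mult peval_single)

lemma mon_degree_add: "mon_degree (a + b) = mon_degree a + mon_degree b"
  by (simp add: mon_degree_def lookup_add sum.distrib)

lemma tdegree_le_iff: "tdegree p \<le> k \<longleftrightarrow> (\<forall>m\<in>Poly_Mapping.keys p. mon_degree m \<le> k)"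
  unfolding tdegree_def by auto

lemma mon_degree_le_tdegree: "m \<in> Poly_Mapping.keys p \<Longrightarrow> mon_degree m \<le> tdegree p"
  using tdegree_le_iff by blast

lemma tdegree_mult_le: "tdegree (p * q) \<le> tdegree p + tdegree q"
  unfolding tdegree_le_iff
proof
  fix m assume "m \<in> Poly_Mapping.keys (p * q)"
  then obtain a b where "a \<in> Poly_Mapping.keys p" "b \<in> Poly_Mapping.keys q" "m = a + b"
    using keys_mult[of p q] by blast
  then show "mon_degree m \<le> tdegree p + tdegree q"
    by (auto simp: mon_degree_add intro!: add_mono mon_degree_le_tdegree)
qed

text \<open>Translation of exponents by \<open>a\<close> is injective, so nothing cancels and a key
  of top degree stays a key. The assumption \<open>p \<noteq> 0\<close> matters because the zero
  polynomial has degree 0.\<close>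

lemma tdegree_single_mult:
  assumes "c \<noteq> 0" "p \<noteq> 0"
  shows "tdegree (Poly_Mapping.single a c * p) = mon_degree a + tdegree p"
proof (rule antisym)
  show "tdegree (Poly_Mapping.single a c * p) \<le> mon_degree a + tdegree p"
    using tdegree_mult_le[of "Poly_Mapping.single a c" p] assms by (simp add: tdegree_def)
  have "tdegree p \<in> mon_degree ` Poly_Mapping.keys p"
  proof -
    have "Poly_Mapping.keys p \<noteq> {}"
      using assms(2) by (metis all_not_in_conv in_keys_iff lookup_zero poly_mapping_eqI)
    then have "tdegree p = Max (mon_degree ` Poly_Mapping.keys p)"
      by (simp add: tdegree_def)
    then show ?thesis
      using \<open>Poly_Mapping.keys p \<noteq> {}\<close> by (simp add: Max_in del: image_iff)
  qed
  then obtain m where m: "m \<in> Poly_Mapping.keys p" "mon_degree m = tdegree p" by auto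
  have "Poly_Mapping.lookup (Poly_Mapping.single a c * p) (a + m) = c * Poly_Mapping.lookup p m"
    by (subst lookup_mult_unique) (use assms in auto)
  then have "a + m \<in> Poly_Mapping.keys (Poly_Mapping.single a c * p)"
    using m assms by (simp add: in_keys_iff)
  then show "mon_degree a + tdegree p \<le> tdegree (Poly_Mapping.single a c * p)"
    using mon_degree_le_tdegree[of "a + m"] m by (simp add: mon_degree_add)
qed

section \<open>Degree-bounded subspaces and sums of squares\<close>

lemma subspace_polys_upto: "mpoly.subspace (polys_upto k :: 'n::finite mpoly set)"
proof (rule mpoly.subspaceI)
  show "x + y \<in> polys_upto k" if "x \<in> polys_upto k" "y \<in> polys_upto k" for x y :: "'n mpoly"
    using that keys_add[of x y] by (auto simp: polys_upto_def tdegree_le_iff)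
  show "pscale c x \<in> polys_upto k" if "x \<in> polys_upto k" for c and x :: "'n mpoly"
    using that by (auto simp: polys_upto_def tdegree_le_iff in_keys_iff lookup_pscale)
qed (simp add: polys_upto_def tdegree_le_iff)

lemma subspace_I1: "mpoly.subspace (I1 d A)"
proof -
  have "mpoly.subspace {p. \<forall>\<pi>\<in>A. peval p \<pi> = 0}"
    by (rule mpoly.subspaceI) (auto simp: peval_add peval_pscale)
  moreover have "I1 d A = polys_upto d \<inter> {p. \<forall>\<pi>\<in>A. peval p \<pi> = 0}"
    by (auto simp: I1_def)
  ultimately show ?thesis
    using mpoly.subspace_inter[OF subspace_polys_upto] by simp
qed

text \<open>A monomial of top degree that maximizes the strictly convex function \<open>\<Sum>i. m\<^sub>i\<^sup>2\<close> is not the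
  midpoint of two other ones, so its square cannot cancel in a sum of squares.\<close>

lemma tdegree_le_tdegree_sum_squares:
  fixes h :: "'a \<Rightarrow> 'n::finite mpoly"
  assumes "finite J" "j \<in> J"
  shows "2 * tdegree (h j) \<le> tdegree (\<Sum>j\<in>J. (h j)\<^sup>2)"
proof (cases "h j = 0")
  case False
  define K where "K = (\<Union>j\<in>J. Poly_Mapping.keys (h j))"
  define k where "k = Max (mon_degree ` K)"
  define Q where "Q = (\<lambda>m :: 'n \<Rightarrow>\<^sub>0 nat. \<Sum>i\<in>UNIV. (real (Poly_Mapping.lookup m i))\<^sup>2)"
  have "finite K" using assms by (simp add: K_def)
  have "Poly_Mapping.keys (h j) \<noteq> {}"
    using False by (metis all_not_in_conv in_keys_iff lookup_zero poly_mapping_eqI)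
  then have "K \<noteq> {}" using assms by (auto simp: K_def)
  have le_k: "mon_degree m \<le> k" if "m \<in> K" for m
    using that \<open>finite K\<close> by (auto simp: k_def)
  define L where "L = {m \<in> K. mon_degree m = k}"
  have "k \<in> mon_degree ` K"
    unfolding k_def using \<open>finite K\<close> \<open>K \<noteq> {}\<close> by (intro Max_in) auto
  then have "finite L" "L \<noteq> {}" using \<open>finite K\<close> by (auto simp: L_def)
  then obtain m where m: "m \<in> L" "\<And>a. a \<in> L \<Longrightarrow> Q a \<le> Q m"
    using obtains_MAX[of L Q] by (metis Max_ge finite_imageI imageI)
  have uniq: "a = m \<and> b = m" if "a \<in> K" "b \<in> K" "a + b = m + m" for a b
  proof -
    \<comment> \<open>Neither degree exceeds \<open>k\<close>, so a sum of \<open>2 * k\<close> puts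
      both \<open>a\<close> and \<open>b\<close> in the top layer \<open>L\<close>, where
      \<open>m\<close> maximizes \<open>Q\<close>.\<close>
    have "mon_degree a + mon_degree b = k + k"
      using that(3) m(1) by (metis (mono_tags, lifting) L_def mem_Collect_eq mon_degree_add)
    then have "a \<in> L" "b \<in> L" using that le_k[of a] le_k[of b] by (auto simp: L_def)
    then have "Q a + Q b \<le> 2 * Q m" using m(2)[of a] m(2)[of b] by linarith
    have *: "real (Poly_Mapping.lookup a i) + real (Poly_Mapping.lookup b i) =
        2 * real (Poly_Mapping.lookup m i)" for i
    proof -
      have "Poly_Mapping.lookup (a + b) i = Poly_Mapping.lookup (m + m) i" using that(3) by simp
      then show ?thesis by (simp add: lookup_add)
    qed
    \<comment> \<open>Parallelogram identity with midpoint \<open>m\<close>: the squared distance of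
      \<open>a\<close> and \<open>b\<close> is at most 0, hence \<open>a = b = m\<close>.\<close>
    have "(\<Sum>i\<in>UNIV. (real (Poly_Mapping.lookup a i) - real (Poly_Mapping.lookup b i))\<^sup>2)
        = (\<Sum>i\<in>UNIV. 2 * (real (Poly_Mapping.lookup a i))\<^sup>2 + 2 * (real (Poly_Mapping.lookup b i))\<^sup>2
            - 4 * (real (Poly_Mapping.lookup m i))\<^sup>2)"
    proof (rule sum.cong[OF refl])
      fix i
      show "(real (Poly_Mapping.lookup a i) - real (Poly_Mapping.lookup b i))\<^sup>2 =
        2 * (real (Poly_Mapping.lookup a i))\<^sup>2 + 2 * (real (Poly_Mapping.lookup b i))\<^sup>2
            - 4 * (real (Poly_Mapping.lookup m i))\<^sup>2"
        using *[of i] by algebra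
    qed
    also have "\<dots> = 2 * Q a + 2 * Q b - 4 * Q m"
      by (simp add: Q_def sum_subtractf sum.distrib sum_distrib_left)
    also have "\<dots> \<le> 0" using \<open>Q a + Q b \<le> 2 * Q m\<close> by linarith
    finally have "\<forall>i. (real (Poly_Mapping.lookup a i) - real (Poly_Mapping.lookup b i))\<^sup>2 = 0"
      using sum_nonneg_eq_0_iff[of UNIV "\<lambda>i. (real (Poly_Mapping.lookup a i) - real (Poly_Mapping.lookup b i))\<^sup>2"]
      by (auto intro!: antisym sum_nonneg)
    then have "Poly_Mapping.lookup a i = Poly_Mapping.lookup m i"
        "Poly_Mapping.lookup b i = Poly_Mapping.lookup m i" for i
      using *[of i] by auto
    then show ?thesis by (auto intro: poly_mapping_eqI)
  qed
  \<comment> \<open>\<open>K\<close> contains the keys of every \<open>h j\<close>, so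
    \<open>uniq\<close> serves all summands at once; the coefficient is a sum of real squares, one
    of them nonzero.\<close>
  have "Poly_Mapping.lookup (\<Sum>j\<in>J. (h j)\<^sup>2) (m + m) = (\<Sum>j\<in>J. (Poly_Mapping.lookup (h j) m)\<^sup>2)"
    unfolding lookup_sum power2_eq_square
    by (intro sum.cong refl lookup_mult_unique uniq) (auto simp: K_def)
  moreover obtain l where "l \<in> J" "m \<in> Poly_Mapping.keys (h l)"
    using m(1) by (auto simp: L_def K_def)
  then have "(\<Sum>j\<in>J. (Poly_Mapping.lookup (h j) m)\<^sup>2) > 0"
    using assms by (intro sum_pos2[of J l]) (auto simp: in_keys_iff)
  ultimately have "m + m \<in> Poly_Mapping.keys (\<Sum>j\<in>J. (h j)\<^sup>2)"
    by (simp add: in_keys_iff)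
  from mon_degree_le_tdegree[OF this] have "2 * k \<le> tdegree (\<Sum>j\<in>J. (h j)\<^sup>2)"
    using m(1) by (simp add: mon_degree_add L_def)
  moreover have "tdegree (h j) \<le> k"
    unfolding tdegree_le_iff using assms by (auto intro!: le_k simp: K_def)
  ultimately show ?thesis by linarith
qed (simp add: tdegree_def)

text \<open>Products of two different factors can absorb the scalar and the minus sign. This is how
  a representation by squares places \<open>g\<close> in \<open>I1_squared d A\<close>.\<close>

lemma I1_squared_diff_squares:
  fixes u v :: "nat \<Rightarrow> 'n::finite mpoly"
  assumes "\<And>j. j < k \<Longrightarrow> u j \<in> I1 d A" "\<And>j. j < l \<Longrightarrow> v j \<in> I1 d A"
  shows "pscale c ((\<Sum>j<k. (u j)\<^sup>2) - (\<Sum>j<l. (v j)\<^sup>2)) \<in> I1_squared d A"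
proof -
  define a where "a = (\<lambda>j. if j < k then pscale c (u j) else pscale (- c) (v (j - k)))"
  define b where "b = (\<lambda>j. if j < k then u j else v (j - k))"
  have "(\<Sum>j<k+l. a j * b j) = (\<Sum>j<k. a j * b j) + (\<Sum>j<l. a (k + j) * b (k + j))"
    by (induction l) (simp_all add: add.assoc)
  also have "\<dots> = pscale c ((\<Sum>j<k. (u j)\<^sup>2) - (\<Sum>j<l. (v j)\<^sup>2))"
    by (simp add: a_def b_def pscale_conv_mult sum_distrib_left power2_eq_square mult.assoc
        single_uminus sum_negf right_diff_distrib)
  finally have "pscale c ((\<Sum>j<k. (u j)\<^sup>2) - (\<Sum>j<l. (v j)\<^sup>2)) = (\<Sum>j<k+l. a j * b j)" ..
  moreover have "a j \<in> I1 d A \<and> b j \<in> I1 d A" if "j < k + l" for j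
    unfolding a_def b_def using assms that
    by (cases "j < k") (simp_all add: mpoly.subspace_scale[OF subspace_I1] del: mpoly.scale_minus_left)
  ultimately show ?thesis
    unfolding I1_squared_def by blast
qed

section \<open>Local estimates near a zero\<close>

lemma peval_has_derivative: "(peval p has_derivative (\<lambda>h. h \<bullet> pgrad p x)) (at x)"
  using GDERIV_peval[of p x] by (simp add: gderiv_def)

lemma continuous_on_peval: "continuous_on S (peval p)"
  by (meson continuous_at_imp_continuous_on has_derivative_continuous peval_has_derivative)

lemma peval_linear_bound:
  assumes "peval p z = 0"
  shows "\<exists>M. \<forall>\<^sub>F x in nhds z. \<bar>peval p x\<bar> \<le> M * norm (x - z)"
proof -
  \<comment> \<open>The definition of the derivative with error constant 1.\<close>
  obtain r where r: "r > 0" "\<And>x. norm (x - z) < r \<Longrightarrow>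
      norm (peval p x - peval p z - (x - z) \<bullet> pgrad p z) \<le> 1 * norm (x - z)"
    using peval_has_derivative[of p z] unfolding has_derivative_at_alt by (metis zero_less_one)
  have "\<bar>peval p x\<bar> \<le> (1 + norm (pgrad p z)) * norm (x - z)" if "dist x z < r" for x
  proof -
    have "\<bar>peval p x - (x - z) \<bullet> pgrad p z\<bar> \<le> norm (x - z)"
      using r(2)[of x] that assms by (simp add: dist_norm)
    moreover have "\<bar>(x - z) \<bullet> pgrad p z\<bar> \<le> norm (x - z) * norm (pgrad p z)"
      by (rule Cauchy_Schwarz_ineq2)
    ultimately show ?thesis by (simp add: algebra_simps)
  qed
  then show ?thesis unfolding eventually_nhds_metric using r(1) by blast
qed

text \<open>Each partial derivative is again a polynomial vanishing at \<open>z\<close>, so the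
  gradient is bounded linearly; the mean value inequality supplies the second factor
  \<open>norm (x - z)\<close>.\<close>

lemma peval_quadratic_bound:
  assumes "peval p z = 0" "pgrad p z = 0"
  shows "\<exists>M. \<forall>\<^sub>F x in nhds z. \<bar>peval p x\<bar> \<le> M * (norm (x - z))\<^sup>2"
proof -
  have "peval (ppderiv i p) z = 0" for i
    using arg_cong[OF assms(2), of "\<lambda>v. v $ i"] by (simp add: pgrad_def)
  then have "\<exists>M. \<forall>\<^sub>F x in nhds z. \<bar>peval (ppderiv i p) x\<bar> \<le> M * norm (x - z)" for i
    by (rule peval_linear_bound)
  then obtain M where "\<And>i. \<forall>\<^sub>F x in nhds z. \<bar>peval (ppderiv i p) x\<bar> \<le> M i * norm (x - z)"
    by metis
  then have "\<forall>\<^sub>F x in nhds z. \<forall>i. \<bar>peval (ppderiv i p) x\<bar> \<le> M i * norm (x - z)"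
    by (rule eventually_all_finite)
  then obtain r where r: "r > 0" "\<And>x i. dist x z < r \<Longrightarrow> \<bar>peval (ppderiv i p) x\<bar> \<le> M i * norm (x - z)"
    unfolding eventually_nhds_metric by blast
  define N where "N = max 0 (\<Sum>i\<in>UNIV. M i)"
  have grad: "norm (pgrad p x) \<le> N * norm (x - z)" if "dist x z < r" for x
  proof -
    have "norm (pgrad p x) \<le> (\<Sum>i\<in>UNIV. \<bar>peval (ppderiv i p) x\<bar>)"
      using norm_le_l1_cart[of "pgrad p x"] by (simp add: pgrad_def)
    also have "\<dots> \<le> (\<Sum>i\<in>UNIV. M i * norm (x - z))"
      by (intro sum_mono r that)
    also have "\<dots> = (\<Sum>i\<in>UNIV. M i) * norm (x - z)"
      by (simp add: sum_distrib_right)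
    also have "\<dots> \<le> N * norm (x - z)"
      by (intro mult_right_mono) (auto simp: N_def)
    finally show ?thesis .
  qed
  have "\<bar>peval p x\<bar> \<le> N * (norm (x - z))\<^sup>2" if x: "dist x z < r" for x
  proof -
    have "norm (peval p x - peval p z) \<le> (N * norm (x - z)) * norm (x - z)"
    \<comment> \<open>This ball is convex, contains both \<open>x\<close> and \<open>z\<close>, and
      lies within distance \<open>r\<close> of \<open>z\<close>, where the gradient bound is
      valid.\<close>
    proof (rule differentiable_bound[where S = "cball z (norm (x - z))"
          and f' = "\<lambda>y h. h \<bullet> pgrad p y"])
      fix y assume y: "y \<in> cball z (norm (x - z))"
      show "(peval p has_derivative (\<lambda>h. h \<bullet> pgrad p y)) (at y within cball z (norm (x - z)))"
        by (rule has_derivative_at_withinI[OF peval_has_derivative])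
      have "norm (pgrad p y) \<le> N * norm (y - z)"
        using x y by (intro grad) (auto simp: dist_norm norm_minus_commute)
      also have "\<dots> \<le> N * norm (x - z)"
        using y by (intro mult_left_mono) (auto simp: dist_norm norm_minus_commute N_def)
      finally have le: "norm (pgrad p y) \<le> N * norm (x - z)" .
      show "onorm (\<lambda>h. h \<bullet> pgrad p y) \<le> N * norm (x - z)"
      proof (rule onorm_le)
        fix h
        have "norm (h \<bullet> pgrad p y) \<le> norm h * norm (pgrad p y)"
          by (simp add: Cauchy_Schwarz_ineq2)
        also have "\<dots> \<le> norm h * (N * norm (x - z))"
          using le by (intro mult_left_mono) auto
        finally show "norm (h \<bullet> pgrad p y) \<le> N * norm (x - z) * norm h"
          by (simp add: mult_ac)
      qed
    qed (auto simp: dist_norm norm_minus_commute)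
    then show ?thesis using assms(1) by (simp add: power2_eq_square mult.assoc)
  qed
  then show ?thesis unfolding eventually_nhds_metric using r(1) by blast
qed

text \<open>The \<open>p i\<close> act as local coordinates: jointly they have the identity as
  derivative at \<open>z\<close>, so they control the distance to \<open>z\<close>. Fullness
  provides them.\<close>

lemma norm_le_sum_abs_peval:
  fixes p :: "'n::finite \<Rightarrow> 'n mpoly"
  assumes "\<And>i. peval (p i) z = 0" "\<And>i. pgrad (p i) z = axis i 1"
  shows "\<forall>\<^sub>F x in nhds z. norm (x - z) \<le> 2 * (\<Sum>i\<in>UNIV. \<bar>peval (p i) x\<bar>)"
proof -
  let ?n = "real CARD('n)"
  \<comment> \<open>The error constant \<open>1 / (2 * ?n)\<close> is chosen so that the errors of
    all \<open>?n\<close> coordinates add up to half of \<open>norm (x - z)\<close>, which the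
    left-hand side absorbs.\<close>
  have "\<forall>\<^sub>F x in nhds z. \<bar>(x - z) $ i\<bar> \<le> \<bar>peval (p i) x\<bar> + norm (x - z) / (2 * ?n)" for i
  proof -
    have "1 / (2 * ?n) > 0" by simp
    then obtain r where r: "r > 0" "\<And>x. norm (x - z) < r \<Longrightarrow>
        norm (peval (p i) x - peval (p i) z - (x - z) \<bullet> pgrad (p i) z) \<le> 1 / (2 * ?n) * norm (x - z)"
      using peval_has_derivative[of "p i" z] unfolding has_derivative_at_alt by metis
    have "\<bar>(x - z) $ i\<bar> \<le> \<bar>peval (p i) x\<bar> + norm (x - z) / (2 * ?n)" if "dist x z < r" for x
      using r(2)[of x] that assms[of i] by (auto simp: dist_norm inner_axis)
    then show ?thesis unfolding eventually_nhds_metric using r(1) by blast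
  qed
  then have "\<forall>\<^sub>F x in nhds z. \<forall>i. \<bar>(x - z) $ i\<bar> \<le> \<bar>peval (p i) x\<bar> + norm (x - z) / (2 * ?n)"
    by (rule eventually_all_finite)
  then show ?thesis
  proof eventually_elim
    case (elim x)
    have "norm (x - z) \<le> (\<Sum>i\<in>UNIV. \<bar>(x - z) $ i\<bar>)"
      by (rule norm_le_l1_cart)
    also have "\<dots> \<le> (\<Sum>i\<in>UNIV. \<bar>peval (p i) x\<bar> + norm (x - z) / (2 * ?n))"
      using elim by (intro sum_mono) auto
    also have "\<dots> = (\<Sum>i\<in>UNIV. \<bar>peval (p i) x\<bar>) + norm (x - z) / 2"
      by (simp add: sum.distrib)
    finally show ?case by simp
  qed
qed

text \<open>Take a finite subcover. Since \<open>F\<close> is nonnegative, enlarging a constant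
  keeps its bound, and the sum of the absolute values exceeds each local constant.\<close>

lemma compact_dominated:
  fixes G F :: "'a::topological_space \<Rightarrow> real"
  assumes "compact S" and F: "\<And>x. F x \<ge> 0"
    and local: "\<And>z. z \<in> S \<Longrightarrow> \<exists>C. \<forall>\<^sub>F x in nhds z. G x \<le> C * F x"
  shows "\<exists>C. \<forall>x\<in>S. G x \<le> C * F x"
proof -
  have "\<exists>C U. open U \<and> z \<in> U \<and> (\<forall>x\<in>U. G x \<le> C * F x)" if "z \<in> S" for z
    using local[OF that] unfolding eventually_nhds by blast
  then obtain C U where CU: "\<And>z. z \<in> S \<Longrightarrow> open (U z)" "\<And>z. z \<in> S \<Longrightarrow> z \<in> U z"
      "\<And>z x. z \<in> S \<Longrightarrow> x \<in> U z \<Longrightarrow> G x \<le> C z * F x"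
    by metis
  obtain T where T: "T \<subseteq> S" "finite T" "S \<subseteq> (\<Union>z\<in>T. U z)"
  proof (rule compactE_image[OF assms(1), of S U])
    show "S \<subseteq> (\<Union>z\<in>S. U z)" using CU(2) by blast
  qed (use CU(1) in auto)
  have "G x \<le> (\<Sum>z\<in>T. \<bar>C z\<bar>) * F x" if x: "x \<in> S" for x
  proof -
    obtain z where z: "z \<in> T" "x \<in> U z" using T(3) x by blast
    then have "G x \<le> C z * F x" using CU T by blast
    also have "C z \<le> (\<Sum>z\<in>T. \<bar>C z\<bar>)"
      using member_le_sum[of z T "\<lambda>z. \<bar>C z\<bar>"] z T by auto
    finally show ?thesis using F[of x] by (simp add: mult_right_mono)
  qed
  then show ?thesis by blast
qed

section \<open>Growth at infinity\<close>

lemma peval_upper_bound: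
  assumes "tdegree p \<le> k"
  shows "\<bar>peval p x\<bar> \<le> (\<Sum>m\<in>Poly_Mapping.keys p. \<bar>Poly_Mapping.lookup p m\<bar>) * sqrt (1 + (norm x)\<^sup>2) ^ k"
proof -
  let ?N = "sqrt (1 + (norm x)\<^sup>2)"
  \<comment> \<open>\<open>?N\<close> is the norm of the point \<open>(x, 1)\<close> of the
    homogenizing space. As it is at least 1, monomials of lower degree are bounded by the same
    power.\<close>
  have N: "?N \<ge> 1" "\<bar>x $ i\<bar> \<le> ?N" for i
    using component_le_norm_cart[of x i] real_sqrt_ge_abs2[of "norm x" 1] by auto
  have "\<bar>peval p x\<bar> \<le> (\<Sum>m\<in>Poly_Mapping.keys p. \<bar>Poly_Mapping.lookup p m\<bar> * (\<Prod>i\<in>UNIV. \<bar>x $ i\<bar> ^ Poly_Mapping.lookup m i))"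
    unfolding peval_def by (rule order_trans[OF sum_abs]) (simp add: abs_mult abs_prod power_abs)
  also have "\<dots> \<le> (\<Sum>m\<in>Poly_Mapping.keys p. \<bar>Poly_Mapping.lookup p m\<bar> * ?N ^ k)"
  proof (intro sum_mono mult_left_mono)
    fix m assume m: "m \<in> Poly_Mapping.keys p"
    have "(\<Prod>i\<in>UNIV. \<bar>x $ i\<bar> ^ Poly_Mapping.lookup m i) \<le> (\<Prod>i\<in>UNIV. ?N ^ Poly_Mapping.lookup m i)"
      using N by (intro prod_mono conjI power_mono) auto
    also have "\<dots> = ?N ^ mon_degree m" by (simp add: mon_degree_def power_sum)
    also have "\<dots> \<le> ?N ^ k"
      using mon_degree_le_tdegree[OF m] assms N(1) by (intro power_increasing) auto
    finally show "(\<Prod>i\<in>UNIV. \<bar>x $ i\<bar> ^ Poly_Mapping.lookup m i) \<le> ?N ^ k" .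
  qed simp
  finally show ?thesis by (simp add: sum_distrib_right)
qed

text \<open>On the unit sphere of the homogenizing space the form and the coordinate at infinity have no
  common zero, so at least one of them is bounded away from 0.\<close>

lemma peval_lower_bound_at_infinity:
  fixes p :: "'n::finite mpoly"
  assumes "\<not> zero_at_infinity p"
  shows "\<exists>\<mu> R. \<mu> > 0 \<and> (\<forall>x. norm x \<ge> R \<longrightarrow> \<mu> * sqrt (1 + (norm x)\<^sup>2) ^ tdegree p \<le> \<bar>peval p x\<bar>)"
proof -
  let ?\<Phi> = "\<lambda>a :: real ^ 'n option. max \<bar>peval (homogenize p) a\<bar> \<bar>a $ None\<bar>"
  have "compact (sphere (0 :: real ^ 'n option) 1)" by simp
  moreover have "sphere (0 :: real ^ 'n option) 1 \<noteq> {}"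
    by simp
  moreover have "continuous_on (sphere 0 1) ?\<Phi>"
    by (intro continuous_intros continuous_on_peval)
  ultimately obtain b where b: "b \<in> sphere 0 1" "\<And>a. a \<in> sphere 0 1 \<Longrightarrow> ?\<Phi> b \<le> ?\<Phi> a"
    using continuous_attains_inf[of "sphere 0 1" ?\<Phi>] by blast
  define \<mu> where "\<mu> = ?\<Phi> b"
  have "b \<noteq> 0" using b(1) by auto
  then have "\<mu> > 0"
    using assms by (auto simp: \<mu>_def zero_at_infinity_def less_max_iff_disj)
  \<comment> \<open>The point \<open>(x, 1)\<close> normalized to length 1 has coordinate
    \<open>1 / N\<close> at \<open>None\<close>. From radius \<open>1 / \<mu>\<close> on this is
    below \<open>\<mu>\<close>, so the form itself must be at least \<open>\<mu>\<close> in absolute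
    value.\<close>
  have "\<mu> * sqrt (1 + (norm x)\<^sup>2) ^ tdegree p \<le> \<bar>peval p x\<bar>" if x: "norm x \<ge> 1 / \<mu>" for x
  proof -
    define N where "N = sqrt (1 + (norm x)\<^sup>2)"
    define y :: "real ^ 'n option" where "y = (\<chi> i. case i of None \<Rightarrow> 1 | Some j \<Rightarrow> x $ j)"
    have "N > norm x" "N > 0"
      unfolding N_def by (auto intro: real_less_rsqrt add_pos_nonneg)
    have "y \<bullet> y = 1 + x \<bullet> x"
      by (simp add: inner_vec_def y_def UNIV_option_conv sum.reindex)
    then have "norm y = N"
      by (simp add: norm_eq_sqrt_inner N_def)
    define a where "a = (1 / N) *\<^sub>R y"
    have "a \<in> sphere 0 1"
      using \<open>norm y = N\<close> \<open>N > 0\<close> by (simp add: a_def)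
    then have "\<mu> \<le> ?\<Phi> a" using b(2) by (simp add: \<mu>_def)
    moreover have aN: "a $ None = 1 / N" by (simp add: a_def y_def)
    moreover have "1 / N < \<mu>"
    proof -
      have "1 / \<mu> < N" using x \<open>N > norm x\<close> by linarith
      then show ?thesis using \<open>N > 0\<close> \<open>\<mu> > 0\<close> by (simp add: field_simps)
    qed
    ultimately have "\<mu> \<le> \<bar>peval (homogenize p) a\<bar>"
      using \<open>N > 0\<close> by (auto simp: le_max_iff_disj)
    also have "(\<chi> i. a $ Some i / a $ None) = x"
      using \<open>N > 0\<close> by (simp add: vec_eq_iff a_def y_def)
    then have "peval (homogenize p) a = (1 / N) ^ tdegree p * peval p x"
      using peval_homogenize[of a p] aN \<open>N > 0\<close> by simp
    finally show ?thesis
      using \<open>N > 0\<close> by (simp add: N_def[symmetric] abs_mult field_simps power_divide)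
  qed
  then show ?thesis using \<open>\<mu> > 0\<close> by blast
qed

lemma dominated_at_infinity:
  assumes "\<not> zero_at_infinity p" "tdegree q \<le> tdegree p"
  shows "\<exists>C R. \<forall>x. norm x \<ge> R \<longrightarrow> \<bar>peval q x\<bar> \<le> C * \<bar>peval p x\<bar>"
proof -
  obtain \<mu> R where \<mu>: "\<mu> > 0" "\<And>x. norm x \<ge> R \<Longrightarrow> \<mu> * sqrt (1 + (norm x)\<^sup>2) ^ tdegree p \<le> \<bar>peval p x\<bar>"
    using peval_lower_bound_at_infinity[OF assms(1)] by blast
  define B where "B = (\<Sum>m\<in>Poly_Mapping.keys q. \<bar>Poly_Mapping.lookup q m\<bar>)"
  have "\<bar>peval q x\<bar> \<le> B / \<mu> * \<bar>peval p x\<bar>" if "norm x \<ge> R" for x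
  proof -
    have "\<bar>peval q x\<bar> \<le> B / \<mu> * (\<mu> * sqrt (1 + (norm x)\<^sup>2) ^ tdegree p)"
      using peval_upper_bound[OF assms(2), of x] \<mu>(1) by (simp add: B_def)
    also have "\<dots> \<le> B / \<mu> * \<bar>peval p x\<bar>"
      using \<mu> that by (intro mult_left_mono) (auto simp: B_def intro!: divide_nonneg_pos sum_nonneg)
    finally show ?thesis .
  qed
  then show ?thesis by blast
qed


section \<open>The sum of squares of a basis\<close>

lemma span_abs_peval_le:
  fixes f :: "nat \<Rightarrow> 'n::finite mpoly"
  assumes "p \<in> mpoly.span (f ` {1..s})"
  shows "\<exists>C. \<forall>x. \<bar>peval p x\<bar> \<le> C * sqrt (peval (\<Sum>j=1..s. (f j)\<^sup>2) x)"
proof -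
  define F where "F = (\<Sum>j=1..s. (f j)\<^sup>2)"
  \<comment> \<open>The polynomials dominated by the square root of \<open>F\<close> form a subspace
    containing every \<open>f j\<close>, hence the whole span.\<close>
  let ?V = "{p :: 'n mpoly. \<exists>C. \<forall>x. \<bar>peval p x\<bar> \<le> C * sqrt (peval F x)}"
  have "f ` {1..s} \<subseteq> ?V"
  proof clarify
    fix j assume "j \<in> {1..s}"
    then have "(peval (f j) x)\<^sup>2 \<le> peval F x" for x
      using member_le_sum[of j "{1..s}" "\<lambda>j. (peval (f j) x)\<^sup>2"]
      by (simp add: F_def peval_sum peval_power2)
    then have "\<bar>peval (f j) x\<bar> \<le> 1 * sqrt (peval F x)" for x
      by (simp add: real_le_rsqrt)
    then show "\<exists>C. \<forall>x. \<bar>peval (f j) x\<bar> \<le> C * sqrt (peval F x)" by blast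
  qed
  moreover have "mpoly.subspace ?V"
  proof (rule mpoly.subspaceI)
    show "0 \<in> ?V" by (auto intro: exI[of _ 0])
  next
    fix p q :: "'n mpoly" assume "p \<in> ?V" "q \<in> ?V"
    then obtain C D where "\<And>x. \<bar>peval p x\<bar> \<le> C * sqrt (peval F x)" "\<And>x. \<bar>peval q x\<bar> \<le> D * sqrt (peval F x)"
      by blast
    then have "\<bar>peval (p + q) x\<bar> \<le> (C + D) * sqrt (peval F x)" for x
      unfolding peval_add distrib_right by (meson abs_triangle_ineq add_mono order_trans)
    then show "p + q \<in> ?V" by blast
  next
    fix c and p :: "'n mpoly" assume "p \<in> ?V"
    then obtain C where "\<And>x. \<bar>peval p x\<bar> \<le> C * sqrt (peval F x)" by blast
    then have "\<bar>peval (pscale c p) x\<bar> \<le> (\<bar>c\<bar> * C) * sqrt (peval F x)" for x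
      by (simp add: peval_pscale abs_mult mult.assoc mult_left_mono)
    then show "pscale c p \<in> ?V" by blast
  qed
  ultimately have "p \<in> ?V"
    using assms mpoly.span_minimal by blast
  then show ?thesis by (simp add: F_def)
qed

text \<open>If all elements of the basis had degree below \<open>d\<close>, then multiplying one of top degree by a
  variable would give an element of the span of larger degree.\<close>

lemma sum_squares_basis_tdegree:
  fixes f :: "nat \<Rightarrow> 'n::finite mpoly"
  assumes "is_basis f s (I1 d A)" "\<not> zero_at_infinity (\<Sum>j=1..s. (f j)\<^sup>2)"
  shows "2 * d \<le> tdegree (\<Sum>j=1..s. (f j)\<^sup>2)"
proof -
  have span: "mpoly.span (f ` {1..s}) = I1 d A"
    using assms(1) by (simp add: is_basis_def)
  define J where "J = {j \<in> {1..s}. f j \<noteq> 0}"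
  have "J \<noteq> {}"
  proof
    assume "J = {}"
    then have "(\<Sum>j=1..s. (f j)\<^sup>2) = 0" by (auto simp: J_def)
    \<comment> \<open>Any nonzero point with last coordinate 0 is a witness; thus the assumption
      forces some \<open>f j\<close> to be nonzero.\<close>
    moreover have "zero_at_infinity (0 :: 'n mpoly)"
      unfolding zero_at_infinity_def
      by (intro exI[of _ "axis (Some undefined) 1"]) (simp add: homogenize_def axis_def vec_eq_iff)
    ultimately show False using assms(2) by simp
  qed
  moreover have "finite J" by (simp add: J_def)
  ultimately obtain j where j: "j \<in> J" "\<And>i. i \<in> J \<Longrightarrow> tdegree (f i) \<le> tdegree (f j)"
    using obtains_MAX[of J "\<lambda>j. tdegree (f j)"] by (metis Max_ge finite_imageI imageI)
  have "d \<le> tdegree (f j)"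
  proof (rule ccontr)
    assume less: "\<not> d \<le> tdegree (f j)"
    \<comment> \<open>\<open>undefined\<close> names an arbitrary variable. The product still
      vanishes on \<open>A\<close> and has degree at most \<open>d\<close>.\<close>
    define q :: "'n mpoly" where "q = Poly_Mapping.single (Poly_Mapping.single undefined 1) 1 * f j"
    have "tdegree q = 1 + tdegree (f j)"
      using j(1) by (simp add: q_def J_def tdegree_single_mult)
        (simp add: mon_degree_def lookup_single when_def)
    moreover have "f j \<in> I1 d A"
      using j(1) span mpoly.span_base[of "f j" "f ` {1..s}"] by (auto simp: J_def)
    then have "q \<in> I1 d A"
      using less \<open>tdegree q = _\<close> by (auto simp: I1_def polys_upto_def q_def peval_mult)
    moreover have "f ` {1..s} \<subseteq> polys_upto (tdegree (f j))"
    proof clarify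
      fix i assume "i \<in> {1..s}"
      then show "f i \<in> polys_upto (tdegree (f j))"
        using j(2)[of i] by (cases "f i = 0") (auto simp: J_def polys_upto_def tdegree_def)
    qed
    then have "I1 d A \<subseteq> polys_upto (tdegree (f j))"
      using mpoly.span_minimal[OF _ subspace_polys_upto] span by blast
    ultimately show False by (auto simp: polys_upto_def)
  qed
  moreover have "2 * tdegree (f j) \<le> tdegree (\<Sum>j=1..s. (f j)\<^sup>2)"
    using j(1) by (intro tdegree_le_tdegree_sum_squares) (auto simp: J_def)
  ultimately show ?thesis by linarith
qed

section \<open>Positivity and failure of sos for the perturbed sum of squares\<close>

theorem theorem3p4:
  fixes A :: "(real ^ 'n::finite) set"
    and d s :: nat
    and f :: "nat \<Rightarrow> 'n mpoly"
    and g :: "'n mpoly"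
  assumes "d \<ge> 1"
    and "finite A"
    and "is_basis f s (I1 d A)"
    and "finite (extra_zeros f s A)"
    and "full d A"
    and "\<not> zero_at_infinity (\<Sum>j=1..s. (f j)\<^sup>2)"
    and "g \<in> I2 (2 * d) A - I1_squared d A"
    and "\<And>w. w \<in> extra_zeros f s A \<Longrightarrow> peval g w > 0"
  shows "\<exists>c::real. c > 0 \<and> positive_poly ((\<Sum>j=1..s. (f j)\<^sup>2) + pscale c g) \<and>
           \<not> sos_poly ((\<Sum>j=1..s. (f j)\<^sup>2) + pscale c g)"
proof -
  define F where "F = (\<Sum>j=1..s. (f j)\<^sup>2)"
  have span: "mpoly.span (f ` {1..s}) = I1 d A"
    using assms(3) by (simp add: is_basis_def)
  then have fI: "f j \<in> I1 d A" if "j \<in> {1..s}" for j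
    using mpoly.span_base[of "f j" "f ` {1..s}"] that by auto
  have pF: "peval F x = (\<Sum>j=1..s. (peval (f j) x)\<^sup>2)" for x
    by (simp add: F_def peval_sum peval_power2)
  then have F_nonneg: "peval F x \<ge> 0" for x
    by (simp add: sum_nonneg)
  have F_deg: "2 * d \<le> tdegree F"
    unfolding F_def using sum_squares_basis_tdegree[OF assms(3,6)] .
  have g: "tdegree g \<le> 2 * d" "\<And>z. z \<in> A \<Longrightarrow> peval g z = 0" "\<And>z. z \<in> A \<Longrightarrow> pgrad g z = 0"
    using assms(7) by (auto simp: I2_def polys_upto_def pgrad_def vec_eq_iff)
  have ev_pos: "\<forall>\<^sub>F x in nhds z. h x > 0" if "continuous_on UNIV h" "h z > 0"
    for h :: "real ^ 'n \<Rightarrow> real" and z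
    using that open_Collect_less[of "\<lambda>_. 0" h] unfolding eventually_nhds by auto
  have local: "\<exists>C. \<forall>\<^sub>F x in nhds z. - peval g x \<le> C * peval F x" for z
  proof -
    \<comment> \<open>A zero of \<open>F\<close> is a common zero of the \<open>f j\<close>, hence
      in \<open>A\<close> or among the extra zeros.\<close>
    consider "peval F z > 0" | "z \<in> extra_zeros f s A" | "z \<in> A"
      using F_nonneg[of z] by (force simp: extra_zeros_def pF sum_nonneg_eq_0_iff order_le_less)
    then show ?thesis
    proof cases
      case 1
      \<comment> \<open>Chosen so that \<open>C * peval F z + peval g z\<close> is at least 1;
        positivity persists nearby by continuity.\<close>
      define C where "C = (1 + \<bar>peval g z\<bar>) / peval F z"
      have "\<forall>\<^sub>F x in nhds z. C * peval F x + peval g x > 0"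
        using 1 by (intro ev_pos continuous_intros continuous_on_peval) (auto simp: C_def)
      then show ?thesis
        by (intro exI[of _ C]) (auto elim!: eventually_mono)
    next
      case 2
      then have "\<forall>\<^sub>F x in nhds z. peval g x > 0"
        using assms(8) by (intro ev_pos continuous_on_peval) auto
      then show ?thesis
        by (intro exI[of _ 0]) (auto elim!: eventually_mono)
    next
      case 3
      obtain p where p: "\<And>i. p i \<in> I1 d A" "\<And>i. pgrad (p i) z = axis i 1"
      proof -
        have "\<exists>p\<in>I1 d A. pgrad p z = axis i 1" for i
          using assms(5) 3 by (auto simp: full_def)
        then show ?thesis using that by metis
      qed
      then have p0: "peval (p i) z = 0" for i
        using 3 by (auto simp: I1_def)
      obtain C where C: "\<And>i x. \<bar>peval (p i) x\<bar> \<le> C i * sqrt (peval F x)"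
      proof -
        have "\<exists>C. \<forall>x. \<bar>peval (p i) x\<bar> \<le> C * sqrt (peval F x)" for i
          using span_abs_peval_le[OF p(1)[folded span]] by (simp add: F_def)
        then show ?thesis using that by metis
      qed
      obtain M where M: "\<forall>\<^sub>F x in nhds z. \<bar>peval g x\<bar> \<le> M * (norm (x - z))\<^sup>2"
        using peval_quadratic_bound[of g z] g 3 by blast
      \<comment> \<open>The local coordinates \<open>p i\<close> lie in the span of the
        \<open>f j\<close>, so the distance to \<open>z\<close> is at most \<open>K\<close> times
        the square root of \<open>F\<close>. Squaring matches the quadratic bound on
        \<open>g\<close>.\<close>
      define K where "K = 2 * (\<Sum>i\<in>UNIV. C i)"
      from M norm_le_sum_abs_peval[of p z, OF p0 p(2)]
      have "\<forall>\<^sub>F x in nhds z. - peval g x \<le> (\<bar>M\<bar> * K\<^sup>2) * peval F x"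
      proof eventually_elim
        case (elim x)
        have "norm (x - z) \<le> 2 * (\<Sum>i\<in>UNIV. C i * sqrt (peval F x))"
          using elim(2) sum_mono[of UNIV "\<lambda>i. \<bar>peval (p i) x\<bar>" "\<lambda>i. C i * sqrt (peval F x)"] C
          by fastforce
        then have "norm (x - z) \<le> K * sqrt (peval F x)"
          by (simp add: K_def sum_distrib_right mult.assoc)
        then have "(norm (x - z))\<^sup>2 \<le> (K * sqrt (peval F x))\<^sup>2"
          by (intro power_mono) auto
        also have "\<dots> = K\<^sup>2 * peval F x"
          using F_nonneg by (simp add: power_mult_distrib)
        finally have "\<bar>M\<bar> * (norm (x - z))\<^sup>2 \<le> \<bar>M\<bar> * (K\<^sup>2 * peval F x)"
          by (intro mult_left_mono) auto
        moreover have "M * (norm (x - z))\<^sup>2 \<le> \<bar>M\<bar> * (norm (x - z))\<^sup>2"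
          by (intro mult_right_mono) auto
        ultimately show ?case using elim(1) by simp
      qed
      then show ?thesis by blast
    qed
  qed
  \<comment> \<open>Here \<open>tdegree g \<le> 2 * d \<le> tdegree F\<close> is essential. The
    remaining ball of radius \<open>R\<close> is handled by compactness.\<close>
  obtain C1 R where C1: "\<And>x. norm x \<ge> R \<Longrightarrow> \<bar>peval g x\<bar> \<le> C1 * peval F x"
    using dominated_at_infinity[OF assms(6)[folded F_def], of g] g(1) F_deg F_nonneg by auto
  obtain C2 where C2: "\<And>x. x \<in> cball 0 R \<Longrightarrow> - peval g x \<le> C2 * peval F x"
    using compact_dominated[OF compact_cball F_nonneg local] by metis
  \<comment> \<open>The entry 1 makes \<open>C\<close> positive, so that \<open>1 / C\<close> can
    serve as the required \<open>c\<close>.\<close>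
  define C where "C = Max {1, C1, C2}"
  have "C > 0" "C1 \<le> C" "C2 \<le> C" by (auto simp: C_def less_max_iff_disj)
  have "- peval g x \<le> C * peval F x" for x
  proof (cases "norm x \<ge> R")
    case True
    then show ?thesis
      using C1[OF True] mult_right_mono[OF \<open>C1 \<le> C\<close> F_nonneg[of x]] by linarith
  next
    case False
    then show ?thesis
      using C2[of x] mult_right_mono[OF \<open>C2 \<le> C\<close> F_nonneg[of x]] by simp
  qed
  then have "0 \<le> peval g x + C * peval F x" for x
    by (metis add.commute neg_le_iff_le real_0_le_add_iff)
  then have pos: "positive_poly (F + pscale (1 / C) g)"
    using \<open>C > 0\<close> by (auto simp: positive_poly_def peval_add peval_pscale field_simps)
  have "\<not> sos_poly (F + pscale (1 / C) g)"
  proof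
    assume "sos_poly (F + pscale (1 / C) g)"
    then obtain k :: nat and h where h: "F + pscale (1 / C) g = (\<Sum>j<k. (h j)\<^sup>2)"
      unfolding sos_poly_def by blast
    have "F \<in> polys_upto (2 * d)"
      unfolding F_def
    proof (rule mpoly.subspace_sum[OF subspace_polys_upto])
      fix j assume "j \<in> {1..s}"
      then have "tdegree (f j) \<le> d" using fI by (simp add: I1_def polys_upto_def)
      then show "(f j)\<^sup>2 \<in> polys_upto (2 * d)"
        using tdegree_mult_le[of "f j" "f j"] by (simp add: polys_upto_def power2_eq_square)
    qed
    moreover have "pscale (1 / C) g \<in> polys_upto (2 * d)"
      using g(1) by (intro mpoly.subspace_scale[OF subspace_polys_upto]) (simp add: polys_upto_def)
    ultimately have deg: "tdegree (\<Sum>j<k. (h j)\<^sup>2) \<le> 2 * d"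
      using mpoly.subspace_add[OF subspace_polys_upto, of F "2 * d" "pscale (1 / C) g"]
      by (simp add: h polys_upto_def)
    have hI: "h j \<in> I1 d A" if "j < k" for j
    proof -
      have "tdegree (h j) \<le> d"
        using tdegree_le_tdegree_sum_squares[of "{..<k}" j h] deg that by simp
      moreover have "peval (h j) z = 0" if "z \<in> A" for z
      proof -
        \<comment> \<open>Both \<open>F\<close> and \<open>g\<close> vanish at \<open>z\<close>, so
          the real squares of the values of the \<open>h j\<close> add up to 0.\<close>
        have "peval F z = 0" using fI that by (auto simp: pF I1_def)
        then have "(\<Sum>j<k. (peval (h j) z)\<^sup>2) = 0"
          using arg_cong[OF h, of "\<lambda>q. peval q z"] g(2)[OF that]
          by (simp add: peval_add peval_pscale peval_sum peval_power2)
        then show ?thesis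
          using \<open>j < k\<close> by (simp add: sum_nonneg_eq_0_iff)
      qed
      ultimately show ?thesis by (simp add: I1_def polys_upto_def)
    qed
    \<comment> \<open>Shift the index to start at 0, then solve the representation for
      \<open>g\<close> as a scaled difference of sums of squares from \<open>I1 d A\<close>.\<close>
    have "F = (\<Sum>j<s. (f (Suc j))\<^sup>2)"
      by (simp add: F_def sum.atLeast1_atMost_eq)
    then have "pscale (1 / C) g = (\<Sum>j<k. (h j)\<^sup>2) - (\<Sum>j<s. (f (Suc j))\<^sup>2)"
      using h by (simp add: algebra_simps)
    then have "g = pscale C ((\<Sum>j<k. (h j)\<^sup>2) - (\<Sum>j<s. (f (Suc j))\<^sup>2))"
      using \<open>C > 0\<close> by (metis mpoly.scale_one mpoly.scale_scale nonzero_eq_divide_eq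
          mult.commute order_less_irrefl)
    then have "g \<in> I1_squared d A"
      using I1_squared_diff_squares[of k h d A s "\<lambda>j. f (Suc j)" C] hI fI by auto
    then show False using assms(7) by blast
  qed
  then show ?thesis
    using pos \<open>C > 0\<close> unfolding F_def by (intro exI[of _ "1 / C"]) auto
qed

end
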